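(* Suppose that $\ell_2$ steepest descent is applied to the logistic loss $L_n(\cdot)$, initialized at $\beta^0:=0$, with the step-size rule $$\alpha_k := \frac{2\|\nabla L_n(\beta^k)\|_2}{\|\mathbf{X}\|_{2,\infty}^2}\quad\text{for all }k\ge0 .$$ When the data is separable, it holds for all $k\ge1$ that: (i) (margin bound) there exists $i\in\{0,1,\ldots,k\}$ for which the normalized iterate $\bar\beta^i:=\beta^i/\|\beta^i\|_2$ satisfies $$\rho(\bar\beta^i)\ \ge\ \frac{\mathrm{DegSEP}^*\cdot\ln\Big(\frac{\mathrm{DegSEP}^*}{n\|\mathbf{X}\|_{2,\infty}}\sqrt{\frac{3(k+1)}{2\ln(2)}}-1\Big)}{2(\ln(k)+1)};$$ (ii) (shrinkage) $\|\beta^k\|_2\le\dfrac{2\ln(k)}{\mathrm{DegSEP}^*}+\dfrac{2}{\|\mathbf{X}\|_{2,\infty}}$; and (iii) (gradient bound) $\min_{i\in\{0,\ldots,k\}}\|\nabla L_n(\beta^i)\|_2\le\|\mathbf{X}\|_{2,\infty}\sqrt{\dfrac{2\ln(2)}{3(k+1)}}$.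
   Context: Data: $\mathbf{x}_i\in\mathbb{R}^p$, $y_i\in\{-1,1\}$, $i=1,\ldots,n$; $\mathbf{X}\in\mathbb{R}^{n\times p}$ is the matrix whose $i$-th row is $\mathbf{x}_i$. The data is separable if there is $\beta$ with $y_i\beta^T\mathbf{x}_i>0$ for all $i$. The logistic loss is $L_n(\beta):=\frac1n\sum_{i=1}^n\ln(1+\exp(-y_i\beta^T\mathbf{x}_i))$. The margin is $\rho(\beta):=\min_{i}y_i\beta^T\mathbf{x}_i$, and (for the $\ell_2$ norm) $\mathrm{DegSEP}^*:=\max_{\|\beta\|_2\le1}\rho(\beta)$, which is positive when the data is separable. $\|\mathbf{X}\|_{2,\infty}:=\max_{\|\beta\|_2\le1}\|\mathbf{X}\beta\|_\infty=\max_i\|\mathbf{x}_i\|_2$. $\ell_2$ steepest descent: at each iteration $k\ge0$ choose $d^k\in\arg\max_d\{\nabla L_n(\beta^k)^Td:\|d\|_2\le1\}$ and set $\beta^{k+1}:=\beta^k-\alpha_kd^k$. Conventions: $\ln(a):=-\infty$ for $a\le0$; the normalization $\beta/\|\beta\|_2$ is taken to be $0$ if $\beta=0$. *)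

theory Defs
  imports "HOL-Analysis.Analysis"
begin

unbundle inner_syntax

text \<open>
  The data are a matrix \<open>X\<close> with rows \<open>x_i\<close>, indexed by the finite type \<open>'n\<close> of observations and
  the finite type \<open>'p\<close> of features, and a label vector \<open>y\<close>.
\<close>

definition separable :: "real^'p^'n \<Rightarrow> real^'n \<Rightarrow> bool" where
  "separable X y \<longleftrightarrow> (\<exists>\<beta>. \<forall>i. y $ i * (\<beta> \<bullet> row i X) > 0)"

definition logistic_loss :: "real^'p^'n \<Rightarrow> real^'n \<Rightarrow> real^'p \<Rightarrow> real" where
  "logistic_loss X y \<beta> =
     (1 / real CARD('n)) * (\<Sum>i\<in>UNIV. ln (1 + exp (- (y $ i * (\<beta> \<bullet> row i X)))))"

definition margin :: "real^'p^'n \<Rightarrow> real^'n \<Rightarrow> real^'p \<Rightarrow> real" where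
  "margin X y \<beta> = (MIN i. y $ i * (\<beta> \<bullet> row i X))"

text \<open>
  The next two suprema are maxima over the closed Euclidean unit ball: see the lemmas
  \<open>deg_sep_attained\<close> and \<open>norm_2_inf_attained\<close> below.
\<close>

definition deg_sep :: "real^'p^'n \<Rightarrow> real^'n \<Rightarrow> real" where
  "deg_sep X y = (SUP \<beta>\<in>cball 0 1. margin X y \<beta>)"

definition norm_2_inf :: "real^'p^'n \<Rightarrow> real" where
  "norm_2_inf X = (SUP \<beta>\<in>cball 0 1. infnorm (X *v \<beta>))"

text \<open>Meaningful only where \<open>f\<close> is differentiable; for the loss see \<open>GDERIV_logistic_loss\<close>.\<close>

definition gradient :: "('a::real_inner \<Rightarrow> real) \<Rightarrow> 'a \<Rightarrow> 'a" where
  "gradient f x = (THE D. GDERIV f x :> D)"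

text \<open>
  The direction \<open>d k\<close> may be any maximizer (it is not unique where the gradient vanishes), so the
  method is a predicate on the sequences of directions and iterates.
\<close>

definition l2_steepest_descent ::
  "('a::real_inner \<Rightarrow> real) \<Rightarrow> (nat \<Rightarrow> real) \<Rightarrow> (nat \<Rightarrow> 'a) \<Rightarrow> (nat \<Rightarrow> 'a) \<Rightarrow> bool" where
  "l2_steepest_descent f \<alpha> d \<beta> \<longleftrightarrow>
     (\<forall>k. is_arg_max (\<lambda>v. gradient f (\<beta> k) \<bullet> v) (\<lambda>v. norm v \<le> 1) (d k) \<and>
          \<beta> (Suc k) = \<beta> k - \<alpha> k *\<^sub>R d k)"

text \<open>The library's real logarithm is total with other junk values on the nonpositive reals.\<close>

definition ext_ln :: "real \<Rightarrow> ereal" where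
  "ext_ln a = (if a \<le> 0 then - \<infinity> else ereal (ln a))"

lemma continuous_on_margin: "continuous_on S (margin X y)"
proof -
  have *: "continuous_on S (\<lambda>\<beta>. MIN i\<in>I. y $ i * (\<beta> \<bullet> row i X))"
    if "finite I" "I \<noteq> {}" for I
    using that
    by (induction I rule: finite_ne_induct) (auto intro!: continuous_intros)
  show ?thesis
    unfolding margin_def [abs_def] by (rule *) auto
qed

lemma deg_sep_attained:
  obtains \<beta> where "norm \<beta> \<le> 1" "margin X y \<beta> = deg_sep X y"
    "\<And>\<beta>'. norm \<beta>' \<le> 1 \<Longrightarrow> margin X y \<beta>' \<le> deg_sep X y"
proof -
  obtain \<beta> :: "real^'a" where \<beta>: "\<beta> \<in> cball 0 1" "\<forall>\<beta>'\<in>cball 0 1. margin X y \<beta>' \<le> margin X y \<beta>"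
    using continuous_attains_sup [OF compact_cball _ continuous_on_margin, of 0 1 X y] by auto
  then have "deg_sep X y = margin X y \<beta>"
    unfolding deg_sep_def by (intro cSup_eq_maximum) auto
  with \<beta> that show thesis by auto
qed

lemma norm_2_inf_attained:
  obtains \<beta> where "norm \<beta> \<le> 1" "infnorm (X *v \<beta>) = norm_2_inf X"
    "\<And>\<beta>'. norm \<beta>' \<le> 1 \<Longrightarrow> infnorm (X *v \<beta>') \<le> norm_2_inf X"
proof -
  have "continuous_on (cball 0 1) (\<lambda>\<beta>. infnorm (X *v \<beta>))"
    by (intro continuous_on_infnorm linear_continuous_on)
       (simp add: linear_conv_bounded_linear [symmetric])
  then obtain \<beta> where \<beta>: "\<beta> \<in> cball 0 1"
      "\<forall>\<beta>'\<in>cball 0 1. infnorm (X *v \<beta>') \<le> infnorm (X *v \<beta>)"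
    using continuous_attains_sup [OF compact_cball, of 0 1 "\<lambda>\<beta>. infnorm (X *v \<beta>)"] by force
  then have "norm_2_inf X = infnorm (X *v \<beta>)"
    unfolding norm_2_inf_def by (intro cSup_eq_maximum) auto
  with \<beta> that show thesis by auto
qed

lemma gradient_eq:
  assumes "GDERIV f x :> D"
  shows "gradient f x = D"
  unfolding gradient_def
proof (rule the_equality)
  show "GDERIV f x :> D" by (rule assms)
next
  fix D' assume "GDERIV f x :> D'"
  with assms have "(\<lambda>h. h \<bullet> D') = (\<lambda>h. h \<bullet> D)"
    unfolding gderiv_def by (rule has_derivative_unique[rotated])
  then show "D' = D"
    by (metis inner_commute vector_eq_ldot)
qed

lemma GDERIV_logistic_loss:
  fixes X :: "real^'p^'n"
  shows "GDERIV (logistic_loss X y) \<beta> :>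
    (1 / real CARD('n)) *\<^sub>R
      (\<Sum>i\<in>UNIV. (- y $ i / (1 + exp (y $ i * (\<beta> \<bullet> row i X)))) *\<^sub>R row i X)"
proof -
  have pos: "0 < 1 + exp (t::real)" for t
    by (simp add: add_pos_pos)
  have e: "exp (- t) / (1 + exp (- t)) = 1 / (1 + exp t)" for t :: real
    using pos[of t] pos[of "- t"] by (simp add: divide_simps exp_minus)
  have "((\<lambda>\<beta>. ln (1 + exp (- (y $ i * (\<beta> \<bullet> row i X))))) has_derivative
      (\<lambda>h. h \<bullet> ((- y $ i / (1 + exp (y $ i * (\<beta> \<bullet> row i X)))) *\<^sub>R row i X))) (at \<beta>)" for i
    apply (rule derivative_eq_intros refl pos)+
    using e[of "y $ i * (\<beta> \<bullet> row i X)"]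
    by (simp add: fun_eq_iff field_simps)
  then have "((\<lambda>\<beta>. \<Sum>i\<in>UNIV. ln (1 + exp (- (y $ i * (\<beta> \<bullet> row i X))))) has_derivative
      (\<lambda>h. \<Sum>i\<in>UNIV. h \<bullet> ((- y $ i / (1 + exp (y $ i * (\<beta> \<bullet> row i X)))) *\<^sub>R row i X)))
      (at \<beta>)"
    by (rule has_derivative_sum)
  from has_derivative_mult_right [OF this, of "1 / real CARD('n)"] show ?thesis
    unfolding gderiv_def logistic_loss_def [abs_def] inner_scaleR_right inner_sum_right .
qed

end

theory Submission
  imports Defs
begin

text \<open>
  The step-size rule turns steepest descent into gradient descent with the constant step
  \<open>s = 2 / R\<^sup>2\<close>, where \<open>R\<close> bounds the norms of the rows, while the loss is \<open>R\<^sup>2 / 4\<close>-smooth.  The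
  descent inequality then telescopes to the gradient bound.  Combined with convexity it yields
  \<open>norm (\<beta> k - u)\<^sup>2 \<le> norm u\<^sup>2 + 2 s k L(u)\<close> for every comparison point \<open>u\<close>; the choice
  \<open>u = (ln k / DegSEP) \<beta>'\<close> with \<open>\<beta>'\<close> a maximum-margin direction has \<open>L(u) \<le> 1 / k\<close> and gives the
  shrinkage bound.  Finally, testing the gradient against \<open>\<beta>'\<close> shows that a small gradient forces a
  large unnormalized margin, and the shrinkage bound controls the normalization.
\<close>

section \<open>The scalar logistic loss\<close>

lemma logistic_has_real_derivative:
  "((\<lambda>t. ln (1 + exp (- t))) has_real_derivative - 1 / (1 + exp t)) (at t)"
proof -
  have "0 < 1 + exp t" "0 < 1 + exp (- t)"
    by (simp_all add: add_pos_pos)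
  then show ?thesis
    by (auto intro!: derivative_eq_intros simp: field_simps exp_minus)
qed

lemma logistic_deriv_has_real_derivative:
  "((\<lambda>t. - 1 / (1 + exp t)) has_real_derivative exp t / (1 + exp t)\<^sup>2) (at (t::real))"
proof -
  have "1 + exp t \<noteq> 0"
    using exp_gt_zero[of t] by linarith
  then show ?thesis
    by (auto intro!: derivative_eq_intros simp: power2_eq_square)
qed

lemma logistic_above_tangent:
  fixes a b :: real
  shows "ln (1 + exp (- a)) + (- 1 / (1 + exp a)) * (b - a) \<le> ln (1 + exp (- b))"
proof -
  have "convex_on UNIV (\<lambda>t::real. ln (1 + exp (- t)))"
    by (rule f''_ge0_imp_convex[OF _ logistic_has_real_derivative logistic_deriv_has_real_derivative])
       auto
  from convex_on_imp_above_tangent[OF this _ _ _ logistic_has_real_derivative, of a b]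
  show ?thesis
    by simp
qed

text \<open>The second derivative \<open>exp t / (1 + exp t)\<^sup>2\<close> never exceeds 1/4, so
  \<open>t\<^sup>2 / 8\<close> minus the loss is convex. Its tangent inequality, rearranged, is the
  claim.\<close>

lemma logistic_quadratic_upper_bound:
  fixes a b :: real
  shows "ln (1 + exp (- b)) \<le> ln (1 + exp (- a)) + (- 1 / (1 + exp a)) * (b - a) + (b - a)\<^sup>2 / 8"
proof -
  define h where "h = (\<lambda>t::real. t\<^sup>2 / 8 - ln (1 + exp (- t)))"
  have h: "(h has_real_derivative t / 4 - (- 1 / (1 + exp t))) (at t)" for t
    unfolding h_def
    by (rule DERIV_diff[OF _ logistic_has_real_derivative])
       (auto intro!: derivative_eq_intros)
  have h': "((\<lambda>t. t / 4 - (- 1 / (1 + exp t))) has_real_derivative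
      1 / 4 - exp t / (1 + exp t)\<^sup>2) (at t)" for t :: real
    by (rule DERIV_diff[OF _ logistic_deriv_has_real_derivative])
       (auto intro!: derivative_eq_intros)
  have nonneg: "0 \<le> 1 / 4 - exp t / (1 + exp t)\<^sup>2" for t :: real
  proof -
    have "0 < 1 + exp t"
      by (simp add: add_pos_pos)
    moreover have "4 * exp t \<le> (1 + exp t)\<^sup>2"
      using zero_le_power2[of "1 - exp t"] by (simp add: power2_eq_square algebra_simps)
    ultimately show ?thesis
      by (simp add: field_simps)
  qed
  have "convex_on UNIV h"
    by (rule f''_ge0_imp_convex[OF _ h h' nonneg]) auto
  from convex_on_imp_above_tangent[OF this _ _ _ h, of a b]
  have "(a / 4 - (- 1 / (1 + exp a))) * (b - a) \<le> h b - h a"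
    by simp
  moreover have "b\<^sup>2 / 8 - a\<^sup>2 / 8 - a / 4 * (b - a) = (b - a)\<^sup>2 / 8"
    by (simp add: power2_eq_square field_simps)
  ultimately show ?thesis
    unfolding h_def left_diff_distrib by linarith
qed

section \<open>Gradient descent on a smooth convex function\<close>

text \<open>The equality case of Cauchy-Schwarz: for \<open>g \<noteq> 0\<close> the only maximizer
  is the normalized gradient, and for \<open>g = 0\<close> both sides vanish whatever
  \<open>d\<close> is. The ambiguity in the choice of direction therefore never reaches the
  iterates.\<close>

lemma norm_scaleR_steepest_direction:
  fixes g d :: "'a::real_inner"
  assumes "is_arg_max (\<lambda>v. g \<bullet> v) (\<lambda>v. norm v \<le> 1) d"
  shows "norm g *\<^sub>R d = g"
proof (cases "g = 0")
  case False
  have d: "norm d \<le> 1" and max: "\<And>v. norm v \<le> 1 \<Longrightarrow> g \<bullet> v \<le> g \<bullet> d"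
    using assms by (auto simp: is_arg_max_def not_less)
  have "g \<bullet> (g /\<^sub>R norm g) = norm g"
    using False by (simp add: dot_square_norm power2_eq_square)
  with max[of "g /\<^sub>R norm g"] False have "norm g \<le> g \<bullet> d"
    by simp
  then have le: "norm g * norm g \<le> norm g * (g \<bullet> d)"
    by (simp add: mult_left_mono)
  \<comment> \<open>Instead of invoking uniqueness, the squared distance is expanded and bounded by
    0, using \<open>norm d \<le> 1\<close> and \<open>norm g \<le> g \<bullet> d\<close>.\<close>
  have "(norm (norm g *\<^sub>R d - g))\<^sup>2 = (norm g)\<^sup>2 * (norm d)\<^sup>2 - 2 * (norm g * (g \<bullet> d)) + (norm g)\<^sup>2"
    unfolding power2_norm_eq_inner inner_diff_left inner_diff_right
    by (simp add: inner_commute power2_eq_square)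
       (simp add: dot_square_norm power2_eq_square)
  also have "\<dots> \<le> (norm g)\<^sup>2 * 1 - 2 * (norm g * norm g) + (norm g)\<^sup>2"
    using le mult_left_mono[OF power_le_one[OF norm_ge_zero d, of 2], of "(norm g)\<^sup>2"] by simp
  also have "\<dots> = 0"
    by (simp add: power2_eq_square)
  finally show ?thesis
    by simp
qed simp

text \<open>With step \<open>s = 2 / R\<^sup>2\<close>, the first-order gain minus the curvature
  cost is \<open>s - R\<^sup>2 / 8 * s\<^sup>2 = 3 / (2 * R\<^sup>2)\<close>, the coefficient of the
  squared gradient norm.\<close>

lemma gradient_descent_decrease:
  fixes f :: "'a::real_inner \<Rightarrow> real"
  assumes "R > 0"
    and smooth: "\<And>a b. f b \<le> f a + g a \<bullet> (b - a) + R\<^sup>2 / 8 * (norm (b - a))\<^sup>2"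
    and step: "\<And>j. \<beta> (Suc j) = \<beta> j - (2 / R\<^sup>2) *\<^sub>R g (\<beta> j)"
  shows "3 / (2 * R\<^sup>2) * (norm (g (\<beta> j)))\<^sup>2 \<le> f (\<beta> j) - f (\<beta> (Suc j))"
proof -
  let ?s = "2 / R\<^sup>2" and ?N = "(norm (g (\<beta> j)))\<^sup>2"
  have "f (\<beta> (Suc j)) \<le> f (\<beta> j) + g (\<beta> j) \<bullet> (- ?s *\<^sub>R g (\<beta> j))
      + R\<^sup>2 / 8 * (norm (- ?s *\<^sub>R g (\<beta> j)))\<^sup>2"
    using smooth[of "\<beta> (Suc j)" "\<beta> j"] by (simp add: step)
  also have "\<dots> = f (\<beta> j) - ?s * ?N + R\<^sup>2 / 8 * (?s\<^sup>2 * ?N)"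
    by (simp add: dot_square_norm power_mult_distrib power_divide)
  also have "\<dots> = f (\<beta> j) - 3 / (2 * R\<^sup>2) * ?N"
    using \<open>R > 0\<close> by (simp add: field_simps power2_eq_square)
  finally show ?thesis
    by simp
qed

lemma gradient_descent_sum_gradients:
  fixes f :: "'a::real_inner \<Rightarrow> real"
  assumes "R > 0"
    and smooth: "\<And>a b. f b \<le> f a + g a \<bullet> (b - a) + R\<^sup>2 / 8 * (norm (b - a))\<^sup>2"
    and step: "\<And>j. \<beta> (Suc j) = \<beta> j - (2 / R\<^sup>2) *\<^sub>R g (\<beta> j)"
  shows "(\<Sum>j<m. 3 / (2 * R\<^sup>2) * (norm (g (\<beta> j)))\<^sup>2) \<le> f (\<beta> 0) - f (\<beta> m)"
proof (induction m)
  case (Suc m)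
  then show ?case
    using gradient_descent_decrease[where f = f and g = g and \<beta> = \<beta> and j = m, OF assms] by simp
qed simp

text \<open>Expanding the squared distance to \<open>u\<close> after one step leaves a cross term,
  which convexity compares with \<open>f u\<close>, and a squared gradient, which the decrease
  inequality trades for a drop in \<open>f\<close>.\<close>

lemma gradient_descent_distance:
  fixes f :: "'a::real_inner \<Rightarrow> real"
  assumes "R > 0"
    and smooth: "\<And>a b. f b \<le> f a + g a \<bullet> (b - a) + R\<^sup>2 / 8 * (norm (b - a))\<^sup>2"
    and step: "\<And>j. \<beta> (Suc j) = \<beta> j - (2 / R\<^sup>2) *\<^sub>R g (\<beta> j)"
    and convex: "\<And>a b. f a + g a \<bullet> (b - a) \<le> f b"
    and nonneg: "\<And>a. 0 \<le> f a"
  shows "(norm (\<beta> m - u))\<^sup>2 \<le> (norm (\<beta> 0 - u))\<^sup>2 + real m * (4 / R\<^sup>2 * f u)"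
proof (induction m)
  case (Suc m)
  let ?s = "2 / R\<^sup>2" and ?b = "\<beta> m" and ?G = "g (\<beta> m)"
  have s: "0 < ?s"
    using \<open>R > 0\<close> by simp
  have "(norm (\<beta> (Suc m) - u))\<^sup>2 = (norm (?b - u - ?s *\<^sub>R ?G))\<^sup>2"
    by (simp add: step algebra_simps)
  also have "\<dots> = (norm (?b - u))\<^sup>2 - 2 * ?s * (?G \<bullet> (?b - u)) + ?s\<^sup>2 * (norm ?G)\<^sup>2"
    unfolding power2_norm_eq_inner inner_diff_left[of "?b - u"] inner_diff_right[of _ "?b - u"]
    by (simp add: inner_commute power2_eq_square)
  finally have "(norm (\<beta> (Suc m) - u))\<^sup>2
      = (norm (?b - u))\<^sup>2 - 2 * (?s * (?G \<bullet> (?b - u))) + ?s\<^sup>2 * (norm ?G)\<^sup>2"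
    by simp
  moreover have "?s * (f ?b - f u) \<le> ?s * (?G \<bullet> (?b - u))"
    using convex[of ?b u] s by (intro mult_left_mono) (auto simp: inner_diff_right)
  moreover have "?s\<^sup>2 * (norm ?G)\<^sup>2 = ?s * (4 / 3 * (3 / (2 * R\<^sup>2) * (norm ?G)\<^sup>2))"
    using \<open>R > 0\<close> by (simp add: field_simps power2_eq_square)
  moreover have "?s * (4 / 3 * (3 / (2 * R\<^sup>2) * (norm ?G)\<^sup>2))
      \<le> ?s * (4 / 3 * (f ?b - f (\<beta> (Suc m))))"
    using gradient_descent_decrease[where f = f and g = g and \<beta> = \<beta> and j = m, OF assms(1-3)] s
    by (intro mult_left_mono) auto
  ultimately have "(norm (\<beta> (Suc m) - u))\<^sup>2 \<le> (norm (?b - u))\<^sup>2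
      - 2 * (?s * (f ?b - f u)) + ?s * (4 / 3 * (f ?b - f (\<beta> (Suc m))))"
    by linarith
  \<comment> \<open>The drop enters with factor 4/3, below the factor 2 of the convexity term. Both
    values of \<open>f\<close> along the iterates thus end up with a negative sign and can be
    discarded.\<close>
  also have "\<dots> = (norm (?b - u))\<^sup>2 + 2 * ?s * f u
      - ?s * (2 / 3 * f ?b + 4 / 3 * f (\<beta> (Suc m)))"
    by (simp add: right_diff_distrib distrib_left)
  also have "\<dots> \<le> (norm (?b - u))\<^sup>2 + 2 * ?s * f u"
    using s nonneg by (simp add: add_nonneg_nonneg)
  also note Suc
  finally show ?case
    by (simp add: distrib_right add_divide_distrib)
qed simp

section \<open>The logistic loss\<close>

lemma gradient_logistic_loss_inner:
  fixes X :: "real^'p^'n"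
  shows "gradient (logistic_loss X y) a \<bullet> v = (1 / real CARD('n)) *
    (\<Sum>i\<in>UNIV. (- 1 / (1 + exp (y $ i * (a \<bullet> row i X)))) * (y $ i * (v \<bullet> row i X)))"
  unfolding gradient_eq[OF GDERIV_logistic_loss] inner_scaleR_left inner_sum_left
  by (simp add: inner_commute[of v])

lemma abs_row_inner_le_norm_2_inf:
  fixes X :: "real^'p^'n"
  assumes "norm v \<le> 1"
  shows "\<bar>v \<bullet> row i X\<bar> \<le> norm_2_inf X"
proof -
  have "\<bar>v \<bullet> row i X\<bar> = \<bar>(X *v v) $ i\<bar>"
    by (simp add: matrix_vector_mul_component row_def inner_commute)
  also have "\<dots> \<le> infnorm (X *v v)"
    by (rule component_le_infnorm_cart)
  also have "\<dots> \<le> norm_2_inf X"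
    using norm_2_inf_attained assms by metis
  finally show ?thesis .
qed

lemma norm_row_le_norm_2_inf:
  fixes X :: "real^'p^'n"
  shows "norm (row i X) \<le> norm_2_inf X"
proof (cases "row i X = 0")
  case True
  then show ?thesis
    \<comment> \<open>Testing with the zero vector gives
      \<open>0 \<le> norm_2_inf X\<close>.\<close>
    using abs_row_inner_le_norm_2_inf[of 0 i X] by simp
next
  case False
  then show ?thesis
    using abs_row_inner_le_norm_2_inf[of "row i X /\<^sub>R norm (row i X)" i X]
    by (simp add: dot_square_norm power2_eq_square mult.assoc[symmetric])
qed

lemma logistic_loss_zero: "logistic_loss X y 0 = ln 2"
  by (simp add: logistic_loss_def)

lemma logistic_loss_nonneg: "0 \<le> logistic_loss X y a"
  unfolding logistic_loss_def by (intro mult_nonneg_nonneg sum_nonneg) auto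

lemma logistic_loss_above_tangent:
  "logistic_loss X y a + gradient (logistic_loss X y) a \<bullet> (b - a) \<le> logistic_loss X y b"
  unfolding gradient_logistic_loss_inner logistic_loss_def distrib_left[symmetric]
    sum.distrib[symmetric] inner_diff_left right_diff_distrib[of "y $ _"]
  by (intro mult_left_mono sum_mono logistic_above_tangent) auto

text \<open>The scalar bound is applied to each signed score. Labels have square 1 and rows have
  norm at most \<open>norm_2_inf X\<close>, so by Cauchy-Schwarz each quadratic remainder is at most
  \<open>?C\<close>; averaging keeps that constant.\<close>

lemma logistic_loss_quadratic_upper_bound:
  fixes X :: "real^'p^'n"
  assumes labels: "\<And>i. y $ i \<in> {-1, 1}"
  shows "logistic_loss X y b \<le> logistic_loss X y a + gradient (logistic_loss X y) a \<bullet> (b - a)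
    + (norm_2_inf X)\<^sup>2 / 8 * (norm (b - a))\<^sup>2"
proof -
  let ?R = "norm_2_inf X"
  let ?C = "?R\<^sup>2 / 8 * (norm (b - a))\<^sup>2"
  let ?\<phi> = "\<lambda>v i. ln (1 + exp (- (y $ i * (v \<bullet> row i X))))"
  let ?l = "\<lambda>i. (- 1 / (1 + exp (y $ i * (a \<bullet> row i X)))) * (y $ i * ((b - a) \<bullet> row i X))"
  have "?\<phi> b i \<le> ?\<phi> a i + ?l i + ?C" for i
  proof -
    have y2: "(y $ i)\<^sup>2 = 1"
      using labels[of i] by auto
    have "\<bar>(b - a) \<bullet> row i X\<bar> \<le> norm (b - a) * ?R"
      using Cauchy_Schwarz_ineq2[of "b - a" "row i X"] norm_row_le_norm_2_inf[of i X]
      by (meson mult_left_mono norm_ge_zero order_trans)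
    then have "((b - a) \<bullet> row i X)\<^sup>2 \<le> (norm (b - a) * ?R)\<^sup>2"
      by (metis abs_ge_zero power2_abs power_mono)
    then have "(y $ i * ((b - a) \<bullet> row i X))\<^sup>2 / 8 \<le> ?C"
      by (simp add: power_mult_distrib y2 mult.commute)
    with logistic_quadratic_upper_bound[of "y $ i * (b \<bullet> row i X)" "y $ i * (a \<bullet> row i X)"]
    show ?thesis
      by (simp add: inner_diff_left right_diff_distrib)
  qed
  then have "(\<Sum>i\<in>UNIV. ?\<phi> b i) \<le> (\<Sum>i\<in>UNIV. ?\<phi> a i + ?l i + ?C)"
    by (intro sum_mono) auto
  then have "1 / real CARD('n) * (\<Sum>i\<in>UNIV. ?\<phi> b i)
      \<le> 1 / real CARD('n) * ((\<Sum>i\<in>UNIV. ?\<phi> a i) + (\<Sum>i\<in>UNIV. ?l i) + real CARD('n) * ?C)"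
    unfolding sum.distrib by (intro mult_left_mono) simp_all
  then show ?thesis
    unfolding gradient_logistic_loss_inner logistic_loss_def by (simp add: distrib_left)
qed

section \<open>Margins\<close>

lemma margin_le: "margin X y v \<le> y $ i * (v \<bullet> row i X)"
  unfolding margin_def by (rule Min_le) auto

lemma margin_attained: "\<exists>i. margin X y v = y $ i * (v \<bullet> row i X)"
proof -
  have "margin X y v \<in> range (\<lambda>i. y $ i * (v \<bullet> row i X))"
    unfolding margin_def by (rule Min_in) auto
  then show ?thesis
    by auto
qed

lemma margin_zero: "margin X y 0 = 0"
  using margin_attained[of X y 0] by auto

lemma margin_scaleR:
  assumes "0 \<le> c"
  shows "margin X y (c *\<^sub>R v) = c * margin X y v"
proof (rule antisym)
  obtain i where "margin X y v = y $ i * (v \<bullet> row i X)"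
    using margin_attained by blast
  with margin_le[of X y "c *\<^sub>R v" i] show "margin X y (c *\<^sub>R v) \<le> c * margin X y v"
    by (simp add: mult.left_commute)
next
  obtain i where i: "margin X y (c *\<^sub>R v) = y $ i * ((c *\<^sub>R v) \<bullet> row i X)"
    using margin_attained by blast
  show "c * margin X y v \<le> margin X y (c *\<^sub>R v)"
    using mult_left_mono[OF margin_le[of X y v i] assms] by (simp add: i mult.left_commute)
qed

lemma deg_sep_pos:
  assumes "separable X y"
  shows "0 < deg_sep X y"
proof -
  obtain b where "\<And>i. y $ i * (b \<bullet> row i X) > 0"
    using assms by (auto simp: separable_def)
  then have b: "margin X y b > 0"
    using margin_attained by metis
  then have "b \<noteq> 0"
    by (auto simp: margin_zero)
  with b have "0 < margin X y (b /\<^sub>R norm b)"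
    by (simp add: margin_scaleR)
  also have "\<dots> \<le> deg_sep X y"
    using deg_sep_attained[of X y] \<open>b \<noteq> 0\<close> by (metis norm_sgn order_refl sgn_div_norm)
  finally show ?thesis .
qed

lemma deg_sep_le_norm_2_inf:
  fixes X :: "real^'p^'n"
  assumes labels: "\<And>i. y $ i \<in> {-1, 1}"
  shows "deg_sep X y \<le> norm_2_inf X"
proof -
  obtain b where b: "norm b \<le> 1" "margin X y b = deg_sep X y"
    using deg_sep_attained by metis
  obtain i where "margin X y b = y $ i * (b \<bullet> row i X)"
    using margin_attained by blast
  also have "\<dots> \<le> \<bar>b \<bullet> row i X\<bar>"
    using labels[of i] by auto
  also have "\<dots> \<le> norm_2_inf X"
    by (rule abs_row_inner_le_norm_2_inf[OF b(1)])
  finally show ?thesis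
    using b by simp
qed

text \<open>Follows from \<open>ln (1 + x) \<le> x\<close>, since the margin bounds every signed
  score from below. It makes the loss small at a comparison point of large margin.\<close>

lemma logistic_loss_le_exp_margin:
  fixes X :: "real^'p^'n"
  shows "logistic_loss X y v \<le> exp (- margin X y v)"
proof -
  have "ln (1 + exp (- (y $ i * (v \<bullet> row i X)))) \<le> exp (- margin X y v)" for i
  proof -
    have "ln (1 + exp (- (y $ i * (v \<bullet> row i X)))) \<le> exp (- (y $ i * (v \<bullet> row i X)))"
      by (rule ln_add_one_self_le_self) simp
    also have "\<dots> \<le> exp (- margin X y v)"
      using margin_le[of X y v i] by simp
    finally show ?thesis .
  qed
  then have "(\<Sum>i\<in>UNIV. ln (1 + exp (- (y $ i * (v \<bullet> row i X)))))
      \<le> (\<Sum>i\<in>(UNIV :: 'n set). exp (- margin X y v))"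
    by (intro sum_mono) auto
  then show ?thesis
    unfolding logistic_loss_def by (simp add: field_simps)
qed

text \<open>The negative gradient is tested against a maximum-margin direction \<open>b\<close>. All
  summands are then nonnegative, so the single one at an observation attaining the margin of
  \<open>a\<close> is a lower bound, and its weight is
  \<open>1 / (1 + exp (margin X y a))\<close>.\<close>

lemma deg_sep_le_norm_gradient:
  fixes X :: "real^'p^'n"
  assumes pos: "0 < deg_sep X y"
  shows "deg_sep X y \<le>
    real CARD('n) * norm (gradient (logistic_loss X y) a) * (1 + exp (margin X y a))"
proof -
  let ?G = "gradient (logistic_loss X y) a"
  let ?w = "\<lambda>i. 1 / (1 + exp (y $ i * (a \<bullet> row i X)))"
  obtain b where b: "norm b \<le> 1" "margin X y b = deg_sep X y"
    using deg_sep_attained by metis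
  have w: "0 \<le> ?w i" for i
    by (simp add: add_nonneg_nonneg)
  obtain j where j: "margin X y a = y $ j * (a \<bullet> row j X)"
    using margin_attained by blast
  have sep: "deg_sep X y \<le> y $ i * (b \<bullet> row i X)" for i
    using margin_le[of X y b i] b by simp
  have "?w j * deg_sep X y \<le> ?w j * (y $ j * (b \<bullet> row j X))"
    using sep w by (intro mult_left_mono) auto
  also have "\<dots> \<le> (\<Sum>i\<in>UNIV. ?w i * (y $ i * (b \<bullet> row i X)))"
    using w order_trans[OF less_imp_le[OF pos] sep]
    by (intro member_le_sum mult_nonneg_nonneg[OF w]) auto
  also have "\<dots> = real CARD('n) * (?G \<bullet> (- b))"
    unfolding gradient_logistic_loss_inner by (simp add: sum_negf)
  also have "\<dots> \<le> real CARD('n) * norm ?G"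
    using norm_cauchy_schwarz[of ?G "- b"] mult_left_mono[OF b(1), of "norm ?G"]
    by (intro mult_left_mono) auto
  finally have "deg_sep X y / (1 + exp (margin X y a)) \<le> real CARD('n) * norm ?G"
    by (simp add: j)
  moreover have "0 < 1 + exp (margin X y a)"
    by (simp add: add_pos_pos)
  ultimately show ?thesis
    by (simp add: divide_le_eq)
qed


section \<open>The three bounds for steepest descent\<close>

theorem theorem3p4:
  fixes X :: "real^'p^'n" and y :: "real^'n"
    and \<beta> d :: "nat \<Rightarrow> real^'p" and \<alpha> :: "nat \<Rightarrow> real" and k :: nat
  assumes labels: "\<And>i. y $ i \<in> {-1, 1}"
    and sep: "separable X y"
    and descent: "l2_steepest_descent (logistic_loss X y) \<alpha> d \<beta>"
    and init: "\<beta> 0 = 0"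
    and step: "\<And>j. \<alpha> j = 2 * norm (gradient (logistic_loss X y) (\<beta> j)) / (norm_2_inf X)\<^sup>2"
    and k: "k \<ge> 1"
  shows "(\<exists>i\<in>{0..k}.
           ereal (margin X y (\<beta> i /\<^sub>R norm (\<beta> i))) \<ge>
             ereal (deg_sep X y) *
             ext_ln (deg_sep X y / (real CARD('n) * norm_2_inf X) *
                       sqrt (3 * (real k + 1) / (2 * ln 2)) - 1)
             / ereal (2 * (ln (real k) + 1)))
       \<and> norm (\<beta> k) \<le> 2 * ln (real k) / deg_sep X y + 2 / norm_2_inf X
       \<and> (MIN i\<in>{0..k}. norm (gradient (logistic_loss X y) (\<beta> i)))
             \<le> norm_2_inf X * sqrt (2 * ln 2 / (3 * (real k + 1)))"
proof -
  define R where "R = norm_2_inf X"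
  define \<gamma> where "\<gamma> = deg_sep X y"
  define g where "g = gradient (logistic_loss X y)"
  define B where "B = sqrt (2 * ln 2 / (3 * (real k + 1)))"
  have \<gamma>: "0 < \<gamma>"
    unfolding \<gamma>_def by (rule deg_sep_pos[OF sep])
  have \<gamma>R: "\<gamma> \<le> R"
    unfolding \<gamma>_def R_def by (rule deg_sep_le_norm_2_inf[OF labels])
  with \<gamma> have R: "0 < R"
    by simp
  have update: "\<beta> (Suc j) = \<beta> j - (2 / R\<^sup>2) *\<^sub>R g (\<beta> j)" for j
  proof -
    have "norm (g (\<beta> j)) *\<^sub>R d j = g (\<beta> j)"
      using descent unfolding l2_steepest_descent_def g_def
      by (intro norm_scaleR_steepest_direction) auto
    then have "(2 / R\<^sup>2) *\<^sub>R g (\<beta> j) = \<alpha> j *\<^sub>R d j"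
      unfolding step R_def g_def by (metis scaleR_scaleR times_divide_eq_left)
    then show ?thesis
      using descent unfolding l2_steepest_descent_def by simp
  qed
  have smooth: "logistic_loss X y b
      \<le> logistic_loss X y a + g a \<bullet> (b - a) + R\<^sup>2 / 8 * (norm (b - a))\<^sup>2" for a b
    unfolding g_def R_def by (rule logistic_loss_quadratic_upper_bound[OF labels])
  have shrinkage: "norm (\<beta> m) \<le> 2 * ln (real m) / \<gamma> + 2 / R" if "m \<ge> 1" for m
  proof -
    obtain b where b: "norm b \<le> 1" "margin X y b = \<gamma>"
      using deg_sep_attained unfolding \<gamma>_def by metis
    \<comment> \<open>The scaling gives \<open>u\<close> margin \<open>ln m\<close>, hence loss at
      most \<open>1 / m\<close>, which cancels the factor \<open>m\<close> in the distance bound.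
      For \<open>m = 1\<close> the point is 0.\<close>
    define u where "u = (ln (real m) / \<gamma>) *\<^sub>R b"
    have c: "0 \<le> ln (real m) / \<gamma>"
      using that \<gamma> by simp
    have u: "norm u \<le> ln (real m) / \<gamma>"
      unfolding u_def norm_scaleR abs_of_nonneg[OF c] using mult_left_mono[OF b(1) c] by simp
    have "margin X y u = ln (real m)"
      unfolding u_def margin_scaleR[OF c] b using \<gamma> by simp
    then have "logistic_loss X y u \<le> 1 / real m"
      using logistic_loss_le_exp_margin[of X y u] that by (simp add: exp_minus inverse_eq_divide)
    then have "real m * (4 / R\<^sup>2 * logistic_loss X y u) \<le> real m * (4 / R\<^sup>2 * (1 / real m))"
      by (intro mult_left_mono) auto
    then have "real m * (4 / R\<^sup>2 * logistic_loss X y u) \<le> (2 / R)\<^sup>2"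
      using that by (simp add: power_divide)
    moreover have "(norm (\<beta> m - u))\<^sup>2 \<le> (norm (\<beta> 0 - u))\<^sup>2 + real m * (4 / R\<^sup>2 * logistic_loss X y u)"
      by (rule gradient_descent_distance
            [where f = "logistic_loss X y" and g = g and \<beta> = \<beta>, OF R smooth update _ logistic_loss_nonneg])
         (simp add: g_def logistic_loss_above_tangent)
    ultimately have "(norm (\<beta> m - u))\<^sup>2 \<le> (norm u)\<^sup>2 + (2 / R)\<^sup>2"
      by (simp add: init)
    also have "\<dots> \<le> (norm u + 2 / R)\<^sup>2"
      using R by (simp add: power2_sum)
    finally have "norm (\<beta> m - u) \<le> norm u + 2 / R"
      by (rule power2_le_imp_le) (use R in simp)
    then show ?thesis
      using norm_triangle_sub[of "\<beta> m" u] u by simp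
  qed
  \<comment> \<open>An index of smallest gradient proves the gradient bound and is also the witness
    for the margin bound in its nontrivial case.\<close>
  have "(MIN i\<in>{0..k}. norm (g (\<beta> i))) \<in> (\<lambda>i. norm (g (\<beta> i))) ` {0..k}"
    by (rule Min_in) auto
  then obtain i where i: "(MIN i\<in>{0..k}. norm (g (\<beta> i))) = norm (g (\<beta> i))" "i \<in> {0..k}"
    by (rule imageE)
  from i(2) have "i \<le> k"
    by simp
  have i_le: "norm (g (\<beta> i)) \<le> norm (g (\<beta> j))" if "j \<le> k" for j
    unfolding i(1)[symmetric] using that by (intro Min_le) auto
  have grad: "norm (g (\<beta> i)) \<le> R * B"
  proof -
    \<comment> \<open>The indices from 0 to \<open>k\<close> give \<open>k + 1\<close> gradients, so
      the telescoping sum runs up to the iterate \<open>Suc k\<close>.\<close>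
    have "(real k + 1) * (3 / (2 * R\<^sup>2) * (norm (g (\<beta> i)))\<^sup>2)
        = (\<Sum>j<Suc k. 3 / (2 * R\<^sup>2) * (norm (g (\<beta> i)))\<^sup>2)"
      by (simp add: algebra_simps)
    also have "\<dots> \<le> (\<Sum>j<Suc k. 3 / (2 * R\<^sup>2) * (norm (g (\<beta> j)))\<^sup>2)"
      using i_le by (intro sum_mono mult_left_mono power_mono) auto
    also have "\<dots> \<le> logistic_loss X y (\<beta> 0) - logistic_loss X y (\<beta> (Suc k))"
      by (rule gradient_descent_sum_gradients
            [where f = "logistic_loss X y" and g = g and \<beta> = \<beta>, OF R smooth update])
    also have "\<dots> \<le> ln 2"
      using logistic_loss_nonneg[of X y "\<beta> (Suc k)"] by (simp add: init logistic_loss_zero)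
    finally have "(norm (g (\<beta> i)))\<^sup>2 * (3 * (real k + 1)) \<le> R\<^sup>2 * (2 * ln 2)"
      using R by (simp add: pos_divide_le_eq algebra_simps)
    then have "(norm (g (\<beta> i)))\<^sup>2 \<le> R\<^sup>2 * (2 * ln 2 / (3 * (real k + 1)))"
      by (simp add: pos_le_divide_eq)
    also have "\<dots> = (R * B)\<^sup>2"
      unfolding B_def power_mult_distrib by (simp add: real_sqrt_pow2)
    finally show ?thesis
      by (rule power2_le_imp_le) (use R in \<open>auto simp: B_def\<close>)
  qed
  define a where "a = \<gamma> / (real CARD('n) * R) * sqrt (3 * (real k + 1) / (2 * ln 2)) - 1"
  define c where "c = 2 * (ln (real k) + 1)"
  have c: "0 < c"
    unfolding c_def using k by (simp add: add_nonneg_pos)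
  have "B > 0"
    unfolding B_def by simp
  have a_eq: "a = \<gamma> / (real CARD('n) * (R * B)) - 1"
  proof -
    have "sqrt (3 * (real k + 1) / (2 * ln 2)) = 1 / B"
      unfolding B_def by (simp add: real_sqrt_divide)
    then show ?thesis
      unfolding a_def by simp
  qed
  have a_le: "a \<le> exp (margin X y (\<beta> i))"
  proof -
    have "\<gamma> \<le> real CARD('n) * norm (g (\<beta> i)) * (1 + exp (margin X y (\<beta> i)))"
      using deg_sep_le_norm_gradient[of X y "\<beta> i"] \<gamma> unfolding \<gamma>_def g_def by simp
    also have "\<dots> \<le> real CARD('n) * (R * B) * (1 + exp (margin X y (\<beta> i)))"
      using grad by (intro mult_right_mono mult_left_mono) (auto simp: add_nonneg_nonneg)
    finally have "\<gamma> / (real CARD('n) * (R * B)) \<le> 1 + exp (margin X y (\<beta> i))"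
      using R \<open>B > 0\<close> by (simp add: pos_divide_le_eq mult.commute)
    then show ?thesis
      by (simp add: a_eq)
  qed
  have "\<exists>i\<in>{0..k}. ereal (margin X y (\<beta> i /\<^sub>R norm (\<beta> i))) \<ge> ereal \<gamma> * ext_ln a / ereal c"
  \<comment> \<open>Here the claimed lower bound is minus infinity, and any index will do.\<close>
  proof (cases "a \<le> 0")
    case True
    then show ?thesis
      using \<gamma> c by (auto simp: ext_ln_def)
  next
    case False
    have "\<exists>i\<in>{0..k}. margin X y (\<beta> i /\<^sub>R norm (\<beta> i)) \<ge> \<gamma> * ln a / c"
    proof (cases "ln a \<le> 0")
      case True
      then have "\<gamma> * ln a / c \<le> 0"
        using \<gamma> c by (simp add: divide_le_0_iff mult_le_0_iff)
      \<comment> \<open>A nonpositive bound is met by the initial iterate: it is 0, its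
        normalization is 0 because \<open>inverse 0 = 0\<close>, and its margin is 0.\<close>
      then show ?thesis
        by (intro bexI[of _ 0]) (auto simp: init margin_zero)
    next
      case ln_pos: False
      have ln_le: "ln a \<le> margin X y (\<beta> i)"
        using a_le False ln_mono[of a "exp (margin X y (\<beta> i))"] by simp
      \<comment> \<open>A positive margin excludes the initial point, so \<open>i \<ge> 1\<close>
        and the shrinkage bound applies at \<open>i\<close>.\<close>
      with ln_pos have "\<beta> i \<noteq> 0"
        by (auto simp: margin_zero)
      then have "i \<ge> 1"
        using init by (metis One_nat_def Suc_leI neq0_conv)
      have "norm (\<beta> i) \<le> 2 * ln (real i) / \<gamma> + 2 / R"
        by (rule shrinkage) fact
      \<comment> \<open>Weakening \<open>2 / R\<close> to \<open>2 / \<gamma>\<close>, by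
        \<open>\<gamma> \<le> R\<close>, merges both terms into \<open>c / \<gamma>\<close> and
        produces the denominator of the margin bound.\<close>
      also have "\<dots> \<le> 2 * ln (real k) / \<gamma> + 2 / \<gamma>"
        using \<open>i \<ge> 1\<close> \<open>i \<le> k\<close> \<gamma> \<gamma>R by (intro add_mono divide_right_mono divide_left_mono) auto
      also have "\<dots> = c / \<gamma>"
        by (simp add: c_def add_divide_distrib distrib_left)
      finally have "norm (\<beta> i) \<le> c / \<gamma>" .
      then have "ln a / (c / \<gamma>) \<le> margin X y (\<beta> i) / norm (\<beta> i)"
        using ln_le ln_pos \<open>\<beta> i \<noteq> 0\<close> by (intro frac_le) auto
      then have "\<gamma> * ln a / c \<le> margin X y (\<beta> i /\<^sub>R norm (\<beta> i))"
        by (simp add: margin_scaleR divide_inverse mult_ac)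
      with i(2) show ?thesis
        by blast
    qed
    with False c show ?thesis
      by (simp add: ext_ln_def)
  qed
  moreover have "norm (\<beta> k) \<le> 2 * ln (real k) / \<gamma> + 2 / R"
    by (rule shrinkage[OF k])
  moreover have "(MIN i\<in>{0..k}. norm (g (\<beta> i))) \<le> R * B"
    using grad i(1) by simp
  ultimately show ?thesis
    unfolding a_def c_def B_def R_def \<gamma>_def g_def by (intro conjI)
qed

end
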